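(* Let $X \in \mathbb{R}^{n_1\times n_2}$ with $r = \operatorname{rank}(X)$, and suppose $X = U_1 G U_2^\top$ where $U_1 \in \mathbb{R}^{n_1\times r}_+$ and $U_2 \in \mathbb{R}^{n_2\times r}_+$ are separable matrices and $G \in \mathbb{R}^{r\times r}$. Then for any other decomposition $X = U_1^* G^* (U_2^* )^\top$ of size $r$ (that is, $U_1^* \in \mathbb{R}^{n_1\times r}_+$, $G^*\in\mathbb{R}^{r\times r}$, $U_2^*\in\mathbb{R}^{n_2\times r}_+$) where $U_1^*$ and $U_2^*$ are separable, there exist permutation matrices $\Pi_1,\Pi_2$ and (invertible) diagonal matrices $D_1,D_2$ of size $r\times r$ such that $U_i^* = U_i D_i \Pi_i$ for $i\in\{1,2\}$ and $G^* = \Pi_1^\top D_1^{-1} G D_2^{-1}\Pi_2$.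
   Context: A matrix $H \in \mathbb{R}^{n\times r}_+$ (entrywise nonnegative) is called separable if there exists an index set $\mathcal{K}\subseteq\{1,\dots,n\}$ with $|\mathcal{K}| = r$ such that the submatrix $H(\mathcal{K},:)$ of rows indexed by $\mathcal K$ (suitably ordered) is a diagonal matrix with positive diagonal elements. *)

theory Defs
  imports
    "Jordan_Normal_Form.DL_Rank"
    "Jordan_Normal_Form.Gauss_Jordan_Elimination"
    "HOL-Combinatorics.Permutations"
begin

definition nonneg_mat :: "real mat \<Rightarrow> bool" where
  "nonneg_mat A \<longleftrightarrow> (\<forall>i<dim_row A. \<forall>j<dim_col A. 0 \<le> A $$ (i, j))"

(* Row indices are 0-based. K is the index set; the bijection s lists it in the
   order that makes the submatrix H(K,:) diagonal. *)
definition separable_mat :: "nat \<Rightarrow> nat \<Rightarrow> real mat \<Rightarrow> bool" where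
  "separable_mat n r H \<longleftrightarrow>
     H \<in> carrier_mat n r \<and> nonneg_mat H \<and>
     (\<exists>K \<subseteq> {0..<n}. card K = r \<and>
        (\<exists>s. bij_betw s {0..<r} K \<and>
           (let HK = mat r r (\<lambda>(i, j). H $$ (s i, j))
            in diagonal_mat HK \<and> (\<forall>i<r. 0 < HK $$ (i, i)))))"

definition permutation_mat :: "nat \<Rightarrow> real mat \<Rightarrow> bool" where
  "permutation_mat r P \<longleftrightarrow>
     (\<exists>p. p permutes {0..<r} \<and> P = mat r r (\<lambda>(i, j). if j = p i then 1 else 0))"

(* Unspecified unless A is square and invertible, since mat_inverse is then None. *)
abbreviation inv_mat :: "real mat \<Rightarrow> real mat" where
  "inv_mat A \<equiv> the (mat_inverse A)"

end

theory Submission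
  imports Defs
begin

text \<open>A separable matrix has an entrywise nonnegative left inverse. Together with the
  invertibility of the cores \<open>G\<close> and \<open>G'\<close> forced by the rank, this gives
  \<open>U\<^sub>i' = U\<^sub>i M\<close> and \<open>U\<^sub>i = U\<^sub>i' N\<close> with \<open>M\<close> and \<open>N\<close> nonnegative and mutually
  inverse. A nonnegative matrix with a nonnegative inverse is a positive diagonal matrix times
  a permutation matrix. The formula for \<open>G'\<close> then follows by cancelling \<open>U\<^sub>1\<close> and \<open>U\<^sub>2\<close>.\<close>

section \<open>Products, transposes and left inverses of nonnegative matrices\<close>

text \<open>The side conditions are equations between dimensions rather than carrier memberships, so
  that the simplifier need not guess inner dimensions when it reassociates long products.\<close>

lemma assoc_mult_mat_dim:
  fixes A B C :: "'a :: semiring_0 mat"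
  assumes "dim_col A = dim_row B" "dim_col B = dim_row C"
  shows "A * B * C = A * (B * C)"
  using assms by (intro assoc_mult_mat[of _ "dim_row A" "dim_row B" _ "dim_row C" _ "dim_col C"]) auto

lemma transpose_mult_dim:
  fixes A B :: "'a :: comm_semiring_0 mat"
  assumes "dim_col A = dim_row B"
  shows "transpose_mat (A * B) = transpose_mat B * transpose_mat A"
  using assms by (intro transpose_mult[of _ "dim_row A" "dim_row B" _ "dim_col B"]) auto

lemma nonneg_mat_mult:
  assumes "A \<in> carrier_mat n m" "B \<in> carrier_mat m k" "nonneg_mat A" "nonneg_mat B"
  shows "nonneg_mat (A * B)"
  using assms unfolding nonneg_mat_def
  by (auto simp: scalar_prod_def intro!: sum_nonneg)

text \<open>Row \<open>s i\<close> of \<open>H\<close> is a positive multiple of the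
  \<open>i\<close>-th unit vector. So \<open>L\<close> only has to select these rows and divide each
  by its diagonal entry.\<close>

lemma separable_mat_nonneg_left_inverse:
  assumes "separable_mat n r H"
  obtains L where "L \<in> carrier_mat r n" "nonneg_mat L" "L * H = 1\<^sub>m r"
proof -
  have H: "H \<in> carrier_mat n r" and nonneg: "nonneg_mat H"
    using assms by (auto simp: separable_mat_def)
  obtain K s where K: "K \<subseteq> {0..<n}" and s: "bij_betw s {0..<r} K"
    and diag: "diagonal_mat (mat r r (\<lambda>(i, j). H $$ (s i, j)))"
    and pos': "\<forall>i<r. 0 < mat r r (\<lambda>(i, j). H $$ (s i, j)) $$ (i, i)"
    using assms unfolding separable_mat_def Let_def by blast
  have sn: "s i < n" if "i < r" for i
    using K bij_betwE[OF s] that by fastforce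
  have off: "H $$ (s i, j) = 0" if "i < r" "j < r" "i \<noteq> j" for i j
    using diag that by (auto simp: diagonal_mat_def)
  have pos: "0 < H $$ (s i, i)" if "i < r" for i
    using pos' that by auto
  define L where "L = mat r n (\<lambda>(i, k). if k = s i then 1 / H $$ (s i, i) else 0)"
  have L: "L \<in> carrier_mat r n" by (simp add: L_def)
  have "nonneg_mat L"
    using pos by (auto simp: nonneg_mat_def L_def less_imp_le)
  moreover have "L * H = 1\<^sub>m r"
  proof (rule eq_matI)
    fix i j assume "i < dim_row (1\<^sub>m r :: real mat)" "j < dim_col (1\<^sub>m r :: real mat)"
    then have ij: "i < r" "j < r" by auto
    have "(L * H) $$ (i, j) = (\<Sum>k<n. L $$ (i, k) * H $$ (k, j))"
      using ij L H by (simp add: scalar_prod_def atLeast0LessThan)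
    also have "\<dots> = (\<Sum>k<n. if k = s i then H $$ (s i, j) / H $$ (s i, i) else 0)"
      using ij by (intro sum.cong) (auto simp: L_def)
    also have "\<dots> = H $$ (s i, j) / H $$ (s i, i)"
      using sn[OF ij(1)] by simp
    finally show "(L * H) $$ (i, j) = 1\<^sub>m r $$ (i, j)"
      using ij off[of i j] pos[of i] by auto
  qed (use L H in auto)
  ultimately show ?thesis using that L by blast
qed

section \<open>Nonnegative matrices with a nonnegative inverse\<close>

text \<open>Nonnegative terms cannot cancel: where an entry of \<open>M * N\<close> or
  \<open>N * M\<close> is 0, every term of its sum is 0. This leaves each row of \<open>M\<close> a
  single positive entry.\<close>

lemma nonneg_mat_nonneg_inverse_monomial:
  assumes M: "M \<in> carrier_mat r r" and N: "N \<in> carrier_mat r r"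
    and nonneg: "nonneg_mat M" "nonneg_mat N" and inv: "M * N = 1\<^sub>m r"
  obtains d P where "\<And>i. i < r \<Longrightarrow> 0 < d i" "permutation_mat r P" "M = mat_diag r d * P"
proof -
  have inv': "N * M = 1\<^sub>m r" using mat_mult_left_right_inverse[OF M N inv] .
  have M0: "0 \<le> M $$ (i, j)" and N0: "0 \<le> N $$ (i, j)" if "i < r" "j < r" for i j
    using nonneg M N that by (auto simp: nonneg_mat_def)
  have MN: "(\<Sum>k<r. M $$ (i, k) * N $$ (k, j)) = (if i = j then 1 else 0)"
    if "i < r" "j < r" for i j
    using arg_cong[OF inv, of "\<lambda>A. A $$ (i, j)"] that M N
    by (simp add: scalar_prod_def atLeast0LessThan)
  have NM: "(\<Sum>k<r. N $$ (i, k) * M $$ (k, j)) = (if i = j then 1 else 0)"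
    if "i < r" "j < r" for i j
    using arg_cong[OF inv', of "\<lambda>A. A $$ (i, j)"] that M N
    by (simp add: scalar_prod_def atLeast0LessThan)
  \<comment> \<open>The diagonal sums of \<open>M * N\<close> equal 1, so one of their terms is
    nonzero.\<close>
  have "\<exists>k<r. 0 < M $$ (i, k) \<and> 0 < N $$ (k, i)" if i: "i < r" for i
  proof (rule ccontr)
    assume neg: "\<not> ?thesis"
    have "M $$ (i, k) * N $$ (k, i) = 0" if "k < r" for k
      using neg M0[OF i that] N0[OF that i] that by (force simp: less_le)
    then have "(\<Sum>k<r. M $$ (i, k) * N $$ (k, i)) = 0" by (intro sum.neutral) auto
    then show False using MN[OF i i] by simp
  qed
  then obtain q where q: "\<And>i. i < r \<Longrightarrow> q i < r"
    and Mq: "\<And>i. i < r \<Longrightarrow> 0 < M $$ (i, q i)" and Nq: "\<And>i. i < r \<Longrightarrow> 0 < N $$ (q i, i)"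
    by metis
  \<comment> \<open>In the vanishing entry \<open>(i, j)\<close> of \<open>M * N\<close>, the term
    \<open>k = q i\<close> has the positive factor \<open>M $$ (i, q i)\<close>, so the other factor
    is 0.\<close>
  have Nq0: "N $$ (q i, j) = 0" if "i < r" "j < r" "i \<noteq> j" for i j
  proof -
    have "\<forall>k\<in>{..<r}. M $$ (i, k) * N $$ (k, j) = 0"
      using MN[of i j] that M0 N0 by (subst sum_nonneg_eq_0_iff[symmetric]) auto
    then show ?thesis using q[of i] Mq[of i] that by force
  qed
  \<comment> \<open>The same argument for the entry \<open>(q i, l)\<close> of \<open>N * M\<close>,
    with the term \<open>k = i\<close>.\<close>
  have Mq0: "M $$ (i, l) = 0" if "i < r" "l < r" "l \<noteq> q i" for i l
  proof -
    have "\<forall>k\<in>{..<r}. N $$ (q i, k) * M $$ (k, l) = 0"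
      using NM[of "q i" l] that q M0 N0 by (subst sum_nonneg_eq_0_iff[symmetric]) auto
    then show ?thesis using Nq[of i] that by force
  qed
  \<comment> \<open>\<open>permutes\<close> demands the identity outside the index range, where
    \<open>q\<close> is unspecified. Injectivity holds because row \<open>q i\<close> of
    \<open>N\<close> is positive only in column \<open>i\<close>.\<close>
  define p where "p i = (if i < r then q i else i)" for i
  have "inj_on p {0..<r}"
  proof (rule inj_onI)
    fix i j assume "i \<in> {0..<r}" "j \<in> {0..<r}" "p i = p j"
    then show "i = j" using Nq0[of i j] Nq[of j] by (auto simp: p_def)
  qed
  moreover have "p ` {0..<r} \<subseteq> {0..<r}" using q by (auto simp: p_def)
  ultimately have "bij_betw p {0..<r} {0..<r}"
    by (simp add: bij_betw_def endo_inj_surj)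
  then have perm: "p permutes {0..<r}"
    by (rule bij_imp_permutes) (auto simp: p_def)
  define P where "P = mat r r (\<lambda>(i, j). if j = p i then 1 else 0 :: real)"
  have "M = mat_diag r (\<lambda>i. M $$ (i, q i)) * P"
    using M Mq0 by (subst mat_diag_mult_left[of _ r r]) (auto simp: P_def p_def)
  then show ?thesis
    using that[of "\<lambda>i. M $$ (i, q i)" P] Mq perm by (auto simp: permutation_mat_def P_def)
qed

section \<open>Inverses of permutation and diagonal matrices\<close>

lemma permutation_mat_orthogonal:
  assumes "permutation_mat r P"
  shows "P \<in> carrier_mat r r" "transpose_mat P * P = 1\<^sub>m r"
proof -
  obtain p where p: "p permutes {0..<r}" and P: "P = mat r r (\<lambda>(i, j). if j = p i then 1 else 0)"
    using assms by (auto simp: permutation_mat_def)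
  show c: "P \<in> carrier_mat r r" by (simp add: P)
  \<comment> \<open>This order compares rows of \<open>P\<close>, which \<open>p\<close> describes
    directly; the other order would require the inverse of \<open>p\<close>.\<close>
  have "P * transpose_mat P = 1\<^sub>m r"
  proof (rule eq_matI)
    fix i j assume "i < dim_row (1\<^sub>m r :: real mat)" "j < dim_col (1\<^sub>m r :: real mat)"
    then have ij: "i < r" "j < r" by auto
    have "(P * transpose_mat P) $$ (i, j) = (\<Sum>k<r. P $$ (i, k) * P $$ (j, k))"
      using ij c by (simp add: scalar_prod_def atLeast0LessThan)
    also have "\<dots> = (\<Sum>k<r. if k = p i then (if p i = p j then 1 else 0) else 0)"
      using ij by (intro sum.cong) (auto simp: P)
    also have "\<dots> = (if p i = p j then 1 else 0)"
      using permutes_in_image[OF p, of i] ij by simp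
    finally show "(P * transpose_mat P) $$ (i, j) = 1\<^sub>m r $$ (i, j)"
      using ij permutes_inj[OF p] by (auto dest: injD)
  qed (use c in auto)
  then show "transpose_mat P * P = 1\<^sub>m r"
    using mat_mult_left_right_inverse[OF c] c by simp
qed

text \<open>As \<open>inv_mat\<close> unwraps an option, the explicit inverse \<open>?E\<close>
  serves to show that \<open>?D\<close> is a unit, which rules out \<open>None\<close>.\<close>

lemma mat_diag_inverse:
  fixes d :: "nat \<Rightarrow> real"
  assumes "\<And>i. i < r \<Longrightarrow> d i \<noteq> 0"
  shows "invertible_mat (mat_diag r d)" "inv_mat (mat_diag r d) \<in> carrier_mat r r"
    "inv_mat (mat_diag r d) * mat_diag r d = 1\<^sub>m r" "mat_diag r d * inv_mat (mat_diag r d) = 1\<^sub>m r"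
proof -
  let ?D = "mat_diag r d" and ?E = "mat_diag r (\<lambda>i. 1 / d i)"
  have D: "?D \<in> carrier_mat r r" and E: "?E \<in> carrier_mat r r" by (auto simp: mat_diag_def)
  have DE: "?D * ?E = 1\<^sub>m r" "?E * ?D = 1\<^sub>m r"
    unfolding mat_diag_diag using assms by (auto simp: mat_diag_def)
  show "invertible_mat ?D"
    using DE carrier_matD[OF D] carrier_matD[OF E]
    by (auto simp: invertible_mat_def inverts_mat_def simp del: mat_diag_diag intro!: exI[of _ ?E])
  have "?D \<in> Units (ring_mat TYPE(real) r ())"
    using D E DE by (auto simp: Units_def ring_mat_def simp del: mat_diag_diag)
  then obtain B where B: "mat_inverse ?D = Some B"
    using mat_inverse(1)[OF D] by fastforce
  show "inv_mat ?D \<in> carrier_mat r r" "inv_mat ?D * ?D = 1\<^sub>m r" "?D * inv_mat ?D = 1\<^sub>m r"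
    using mat_inverse(2)[OF D B] B by auto
qed

section \<open>Rank and invertibility of the core\<close>

text \<open>Some \<open>r\<close> independent columns of the product form
  \<open>Y = A * (G * V)\<close>, where \<open>V\<close> holds the matching columns of
  \<open>B\<close>. If \<open>G\<close> were singular, so would be the square matrix
  \<open>G * V\<close>, and a kernel vector would be a linear dependence among the columns of
  \<open>Y\<close>.\<close>

lemma (in vec_space) full_rank_product_core_det_nonzero:
  assumes A: "A \<in> carrier_mat n r" and G: "G \<in> carrier_mat r r" and B: "B \<in> carrier_mat r m"
    and rank: "rank (A * G * B) = r"
  shows "det G \<noteq> 0"
proof
  assume det: "det G = 0"
  let ?X = "A * G * B"
  have X: "?X \<in> carrier_mat n m" using A G B by simp
  obtain S where S: "maximal S (\<lambda>T. T \<subseteq> set (cols ?X) \<and> lin_indpt T)"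
    using maximal_exists[of "\<lambda>T. T \<subseteq> set (cols ?X) \<and> lin_indpt T" "card (set (cols ?X))" "{}"]
    by (meson List.finite_set card_mono empty_iff empty_subsetI finite_lin_indpt2 rev_finite_subset)
  then have sub: "S \<subseteq> set (cols ?X)" and ind: "lin_indpt S" and card: "card S = r"
    using rank_card_indpt[OF X S] rank by (auto simp: maximal_def)
  have "finite S" using sub finite_subset by blast
  \<comment> \<open>The distinct enumeration matters: a nonzero kernel vector yields a dependence of
    the set of columns only if no column is repeated.\<close>
  then obtain xs where xs: "set xs = S" "distinct xs" "length xs = r"
    using finite_distinct_list card distinct_card by metis
  have "\<exists>j<m. x = col ?X j" if "x \<in> S" for x
  proof -
    from that sub have "x \<in> set (cols ?X)" by blast
    then show ?thesis using carrier_matD(2)[OF B] unfolding cols_def by auto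
  qed
  then obtain f where f: "\<And>x. x \<in> S \<Longrightarrow> f x < m" "\<And>x. x \<in> S \<Longrightarrow> x = col ?X (f x)"
    by metis
  define V where "V = mat_of_cols r (map (\<lambda>x. col B (f x)) xs)"
  have V: "V \<in> carrier_mat r r"
    using mat_of_cols_carrier(1)[of r "map (\<lambda>x. col B (f x)) xs"] xs by (simp add: V_def)
  have carr: "set xs \<subseteq> carrier_vec n"
    using sub xs cols_dim[of ?X] carrier_matD(1)[OF A] by auto
  define Y where "Y = mat_of_cols n xs"
  have Y: "Y \<in> carrier_mat n r" "cols Y = xs"
    using mat_of_cols_carrier(1)[of n xs] xs carr by (simp_all add: Y_def)
  have Y_eq: "Y = A * (G * V)"
  proof (rule mat_col_eqI)
    fix j assume "j < dim_col (A * (G * V))"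
    then have j: "j < r" using V by simp
    have xj: "xs ! j \<in> S" using j xs by auto
    have "col Y j = xs ! j" using cols_nth[of j Y] Y j by simp
    also have "\<dots> = col ?X (f (xs ! j))" using f xj by blast
    also have "\<dots> = A * G *\<^sub>v col B (f (xs ! j))"
      using f(1)[OF xj] A G B by (subst col_mult2[of _ n r _ m]) auto
    also have "\<dots> = A * G *\<^sub>v col V j"
      using j xs col_dim[of B "f (xs ! j)"] carrier_matD(1)[OF B]
      unfolding V_def by (subst col_mat_of_cols) auto
    also have "\<dots> = col (A * (G * V)) j"
      using col_mult2[of "A * G" n r V r j] assoc_mult_mat[OF A G V] A G V j by simp
    finally show "col Y j = col (A * (G * V)) j" .
  qed (use Y A V in auto)
  have GV: "G * V \<in> carrier_mat r r" using G V by simp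
  have "det (G * V) = 0" using det det_mult[OF G V] by simp
  then obtain v where v: "v \<in> carrier_vec r" "v \<noteq> 0\<^sub>v r" "G * V *\<^sub>v v = 0\<^sub>v r"
    using det_0_iff_vec_prod_zero_field[OF GV] by blast
  have "Y *\<^sub>v v = A *\<^sub>v (G * V *\<^sub>v v)"
    unfolding Y_eq using A GV v by (simp add: assoc_mult_mat_vec[of _ n r _ r])
  also have "\<dots> = 0\<^sub>v n" using v A by auto
  finally have "lin_dep (set (cols Y))"
    using lin_depI[OF Y(1) v(1,2)] xs Y by simp
  then show False using ind Y xs by simp
qed

section \<open>Uniqueness of the factors and of the core\<close>

text \<open>Only the left factor is treated; transposing the decomposition turns the right factor
  into a left one, hence the two row counts \<open>n\<close> and \<open>m\<close>.\<close>

lemma separable_factor_unique: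
  assumes U: "separable_mat n r U" and V: "separable_mat m r V"
    and U': "separable_mat n r U'" and V': "separable_mat m r V'"
    and G: "G \<in> carrier_mat r r" "det G \<noteq> 0" and G': "G' \<in> carrier_mat r r" "det G' \<noteq> 0"
    and eq: "U * G * transpose_mat V = U' * G' * transpose_mat V'"
  obtains d P where "\<And>i. i < r \<Longrightarrow> 0 < d i" "permutation_mat r P" "U' = U * mat_diag r d * P"
proof -
  \<comment> \<open>Stated for arbitrary matrices because it is applied in both directions, with the
    two decompositions exchanged.\<close>
  have factor: "B = A * (L * B)"
    if A: "A \<in> carrier_mat n r" and B: "B \<in> carrier_mat n r"
      and C: "C \<in> carrier_mat m r" and E: "E \<in> carrier_mat m r"
      and H: "H \<in> carrier_mat r r" and K: "K \<in> carrier_mat r r" "det K \<noteq> 0"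
      and eq: "A * H * transpose_mat C = B * K * transpose_mat E"
      and L: "L \<in> carrier_mat r n" "L * A = 1\<^sub>m r"
      and R: "R \<in> carrier_mat r m" "R * E = 1\<^sub>m r"
    for A :: "real mat" and B C E H K L R
  proof -
    obtain J where J: "J \<in> carrier_mat r r" "K * J = 1\<^sub>m r"
      using det_non_zero_imp_unit[OF K, of "()"] by (auto simp: Units_def ring_mat_def)
    note dims = A B C E H K(1) L(1) R(1) J(1)
    note dims = dims[THEN carrier_matD(1)] dims[THEN carrier_matD(2)]
    let ?Q = "H * transpose_mat C * transpose_mat R * J"
    have Q: "?Q \<in> carrier_mat r r" by (rule carrier_matI) (simp_all add: dims)
    have ER: "transpose_mat E * transpose_mat R = 1\<^sub>m r"
      using R E dims by (simp flip: transpose_mult_dim)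
    \<comment> \<open>The inserted factors multiply to the identity and complete \<open>B\<close> to
      the common product, which is then rewritten to start with \<open>A\<close>.\<close>
    have "B = B * (K * ((transpose_mat E * transpose_mat R) * J))"
      unfolding ER using J B by simp
    also have "\<dots> = (B * K * transpose_mat E) * transpose_mat R * J"
      by (simp add: assoc_mult_mat_dim dims)
    also have "\<dots> = A * ?Q"
      unfolding eq[symmetric] by (simp add: assoc_mult_mat_dim dims)
    finally have BQ: "B = A * ?Q" .
    have "L * B = L * A * ?Q"
      by (subst BQ) (rule assoc_mult_mat[OF L(1) A Q, symmetric])
    \<comment> \<open>The signs of \<open>?Q\<close> are not visible from its definition; identified
      with \<open>L * B\<close>, it is nonnegative once \<open>L\<close> and \<open>B\<close>
      are.\<close>
    then have "L * B = ?Q" unfolding L(2) left_mult_one_mat[OF Q] .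
    then show ?thesis using BQ by simp
  qed
  have c: "U \<in> carrier_mat n r" "U' \<in> carrier_mat n r" "V \<in> carrier_mat m r" "V' \<in> carrier_mat m r"
    and nn: "nonneg_mat U" "nonneg_mat U'"
    using U U' V V' by (auto simp: separable_mat_def)
  obtain L where L: "L \<in> carrier_mat r n" "nonneg_mat L" "L * U = 1\<^sub>m r"
    using separable_mat_nonneg_left_inverse[OF U] .
  obtain L' where L': "L' \<in> carrier_mat r n" "nonneg_mat L'" "L' * U' = 1\<^sub>m r"
    using separable_mat_nonneg_left_inverse[OF U'] .
  obtain R where R: "R \<in> carrier_mat r m" "R * V = 1\<^sub>m r"
    using separable_mat_nonneg_left_inverse[OF V] .
  obtain R' where R': "R' \<in> carrier_mat r m" "R' * V' = 1\<^sub>m r"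
    using separable_mat_nonneg_left_inverse[OF V'] .
  let ?M = "L * U'" and ?N = "L' * U"
  have M: "?M \<in> carrier_mat r r" and N: "?N \<in> carrier_mat r r" using L L' c by auto
  have U'_eq: "U' = U * ?M"
    by (rule factor[OF c(1,2,3,4) G(1) G' eq L(1,3) R'])
  have U_eq: "U = U' * ?N"
    by (rule factor[OF c(2,1,4,3) G'(1) G eq[symmetric] L'(1,3) R])
  have "?M * ?N = L * (U' * ?N)"
    using L(1) c(2) N by simp
  also have "\<dots> = 1\<^sub>m r" using U_eq L(3) by simp
  finally have "?M * ?N = 1\<^sub>m r" .
  moreover have "nonneg_mat ?M" "nonneg_mat ?N"
    using nonneg_mat_mult L L' c nn by blast+
  ultimately obtain d P where dP: "\<And>i. i < r \<Longrightarrow> 0 < d i" "permutation_mat r P"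
    "?M = mat_diag r d * P"
    using nonneg_mat_nonneg_inverse_monomial[OF M N] by metis
  have "U' = U * mat_diag r d * P"
    using U'_eq c(1) permutation_mat_orthogonal(1)[OF dP(2)]
    unfolding dP(3) by (simp add: assoc_mult_mat_dim mat_diag_def)
  then show ?thesis using that dP by blast
qed

theorem theorem4p1:
  fixes n1 n2 r :: nat
    and X U1 G U2 U1' G' U2' :: "real mat"
  assumes "X \<in> carrier_mat n1 n2"
    and "r = vec_space.rank n1 X"
    and "separable_mat n1 r U1"
    and "separable_mat n2 r U2"
    and "G \<in> carrier_mat r r"
    and "X = U1 * G * transpose_mat U2"
    and "separable_mat n1 r U1'"
    and "separable_mat n2 r U2'"
    and "G' \<in> carrier_mat r r"
    and "X = U1' * G' * transpose_mat U2'"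
  shows "\<exists>P1 P2 D1 D2.
           permutation_mat r P1 \<and> permutation_mat r P2 \<and>
           D1 \<in> carrier_mat r r \<and> diagonal_mat D1 \<and> invertible_mat D1 \<and>
           D2 \<in> carrier_mat r r \<and> diagonal_mat D2 \<and> invertible_mat D2 \<and>
           U1' = U1 * D1 * P1 \<and>
           U2' = U2 * D2 * P2 \<and>
           G' = transpose_mat P1 * inv_mat D1 * G * inv_mat D2 * P2"
proof -
  note G = assms(5) and G' = assms(9)
  have c: "U1 \<in> carrier_mat n1 r" "U1' \<in> carrier_mat n1 r"
    "U2 \<in> carrier_mat n2 r" "U2' \<in> carrier_mat n2 r"
    using assms(3,4,7,8) by (auto simp: separable_mat_def)
  have rank: "vec_space.rank n1 (U1 * G * transpose_mat U2) = r"
    "vec_space.rank n1 (U1' * G' * transpose_mat U2') = r"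
    unfolding assms(6)[symmetric] assms(10)[symmetric] by (rule assms(2)[symmetric])+
  \<comment> \<open>The rank hypothesis enters here, through the determinants of both cores.\<close>
  have det: "det G \<noteq> 0" "det G' \<noteq> 0"
    using vec_space.full_rank_product_core_det_nonzero[OF c(1) G _ rank(1), of n2]
      vec_space.full_rank_product_core_det_nonzero[OF c(2) G' _ rank(2), of n2] c by simp_all
  have eq: "U1 * G * transpose_mat U2 = U1' * G' * transpose_mat U2'"
    using assms(6,10) by (rule subst)
  \<comment> \<open>Transposition exchanges the outer factors, so the uniqueness lemma also applies
    to \<open>U2\<close>.\<close>
  have eqT: "U2 * transpose_mat G * transpose_mat U1 = U2' * transpose_mat G' * transpose_mat U1'"
    using arg_cong[OF eq, of transpose_mat] c G G'
    by (simp add: transpose_mult_dim assoc_mult_mat_dim)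
  obtain d1 P1 where d1: "\<And>i. i < r \<Longrightarrow> 0 < d1 i" and P1: "permutation_mat r P1"
    and U1': "U1' = U1 * mat_diag r d1 * P1"
    using separable_factor_unique[OF assms(3,4,7,8) G det(1) G' det(2) eq] by metis
  have GT: "transpose_mat G \<in> carrier_mat r r" "det (transpose_mat G) \<noteq> 0"
    "transpose_mat G' \<in> carrier_mat r r" "det (transpose_mat G') \<noteq> 0"
    using G G' det by (simp_all add: det_transpose)
  obtain d2 P2 where d2: "\<And>i. i < r \<Longrightarrow> 0 < d2 i" and P2: "permutation_mat r P2"
    and U2': "U2' = U2 * mat_diag r d2 * P2"
    using separable_factor_unique[OF assms(4,3,8,7) GT eqT] by metis
  let ?D1 = "mat_diag r d1" and ?D2 = "mat_diag r d2"
  have d0: "\<And>i. i < r \<Longrightarrow> d1 i \<noteq> 0" "\<And>i. i < r \<Longrightarrow> d2 i \<noteq> 0" using d1 d2 by force+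
  have E1: "invertible_mat ?D1" "inv_mat ?D1 \<in> carrier_mat r r" "inv_mat ?D1 * ?D1 = 1\<^sub>m r"
    using mat_diag_inverse[of r d1] d0(1) by blast+
  have E2: "invertible_mat ?D2" "inv_mat ?D2 \<in> carrier_mat r r" "?D2 * inv_mat ?D2 = 1\<^sub>m r"
    using mat_diag_inverse[of r d2] d0(2) by blast+
  note O1 = permutation_mat_orthogonal[OF P1] and O2 = permutation_mat_orthogonal[OF P2]
  have D: "?D1 \<in> carrier_mat r r" "?D2 \<in> carrier_mat r r" by (auto simp: mat_diag_def)
  have D2T: "transpose_mat ?D2 = ?D2" by (rule eq_matI) (auto simp: mat_diag_def)
  obtain L where L: "L \<in> carrier_mat r n1" "L * U1 = 1\<^sub>m r"
    using separable_mat_nonneg_left_inverse[OF assms(3)] .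
  obtain R where R: "R \<in> carrier_mat r n2" "R * U2 = 1\<^sub>m r"
    using separable_mat_nonneg_left_inverse[OF assms(4)] .
  note dims = c(1,3) G G' D O1(1) O2(1) E1(2) E2(2) L(1) R(1)
  note dims = dims[THEN carrier_matD(1)] dims[THEN carrier_matD(2)]
  have UR: "transpose_mat U2 * transpose_mat R = 1\<^sub>m r"
    using R dims by (simp flip: transpose_mult_dim)
  \<comment> \<open>The core is recovered from the product by a left inverse of \<open>U1\<close>
    and a right inverse of the transpose of \<open>U2\<close>.\<close>
  have cancel: "L * (U1 * A * transpose_mat U2) * transpose_mat R = A"
    if A: "A \<in> carrier_mat r r" for A
  proof -
    have "L * (U1 * A * transpose_mat U2) * transpose_mat R
        = (L * U1) * A * (transpose_mat U2 * transpose_mat R)"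
      using A by (simp add: assoc_mult_mat_dim dims)
    then show ?thesis using A by (simp add: L UR)
  qed
  \<comment> \<open>\<open>?H\<close> is what stands between \<open>U1\<close> and the transpose of
    \<open>U2\<close> once the formulas for \<open>U1'\<close> and \<open>U2'\<close> are
    substituted; \<open>?D2\<close> is symmetric.\<close>
  let ?H = "?D1 * P1 * G' * transpose_mat P2 * ?D2"
  have H: "?H \<in> carrier_mat r r" by (rule carrier_matI) (simp_all add: dims)
  have "U1 * G * transpose_mat U2 = U1 * ?H * transpose_mat U2"
    unfolding eq U1' U2' by (simp add: transpose_mult_dim assoc_mult_mat_dim D2T dims)
  then have "L * (U1 * G * transpose_mat U2) * transpose_mat R
      = L * (U1 * ?H * transpose_mat U2) * transpose_mat R"
    by (rule arg_cong)
  then have G_eq: "G = ?H"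
    unfolding cancel[OF G] cancel[OF H] .
  \<comment> \<open>Solving \<open>G = ?H\<close> for \<open>G'\<close>: regrouping puts each outer
    factor of \<open>?H\<close> next to its inverse.\<close>
  have "transpose_mat P1 * inv_mat ?D1 * ?H * inv_mat ?D2 * P2 =
      transpose_mat P1 * (inv_mat ?D1 * ?D1) * P1 * G' * (transpose_mat P2 * (?D2 * inv_mat ?D2) * P2)"
    by (simp only: assoc_mult_mat_dim dims index_mult_mat index_transpose_mat)
  also have "\<dots> = G'"
    unfolding E1(3) E2(3) using O1 O2 G' by simp
  finally have "G' = transpose_mat P1 * inv_mat ?D1 * G * inv_mat ?D2 * P2"
    unfolding G_eq by (rule sym)
  moreover have "diagonal_mat ?D1" "diagonal_mat ?D2"
    by (auto simp: diagonal_mat_def mat_diag_def)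
  ultimately show ?thesis
    using P1 P2 D E1(1) E2(1) U1' U2' by metis
qed

end
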